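(* Let $d\in\mathbb{N}$, let $H$ be a Hilbert space, and let $K:\mathbb{F}_d^+\times\mathbb{F}_d^+\to\mathcal{L}(H)$ be a positive definite moment kernel with $K^{(1)}:=K-\Sigma K\ge0$. Then there exist unique positive definite kernels $K_{\mathrm{pure}}$ and $K_{\mathrm{unitary}}$ such that $$K=K_{\mathrm{pure}}+K_{\mathrm{unitary}},$$ and the following properties hold: (1) $K_{\mathrm{unitary}}$ is invariant under the free shift: $\Sigma K_{\mathrm{unitary}}=K_{\mathrm{unitary}}$. (2) $\Sigma^NK_{\mathrm{pure}}\to0$ as $N\to\infty$ in the point-weak topology. Moreover, $$K_{\mathrm{unitary}}(\alpha,\beta)=\lim_{N\to\infty}(\Sigma^NK)(\alpha,\beta),\qquad\alpha,\beta\in\mathbb{F}_d^+.$$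
   Context: $\mathbb{F}_d^+$ is the free semigroup on $\{1,\dots,d\}$ with neutral element $\emptyset$. A moment kernel is a kernel $K(\alpha,\beta)=\mathbb{E}[A^\alpha(A^\beta)^*]$ (weak sense) for a $d$-tuple $A=(A_1,\dots,A_d)$ of strongly measurable random operators $A_i:\Omega\to\mathcal{L}(H)$ over a probability space with $\mathbb{E}[\|A^\alpha\|^2]<\infty$ for all $\alpha$, where $A^{\alpha}=A_{i_1}\cdots A_{i_k}$ for $\alpha=i_1\cdots i_k$ and $A^\emptyset=I$. A kernel $K:\mathbb{F}_d^+\times\mathbb{F}_d^+\to\mathcal{L}(H)$ is positive definite, written $K\ge0$, if $\sum_{i,j}\langle u_i,K(\alpha_i,\alpha_j)u_j\rangle\ge0$ for every finite family $\{(\alpha_j,u_j)\}\subset\mathbb{F}_d^+\times H$. The free shift is $(\Sigma K)(\alpha,\beta):=\sum_{i=1}^dK(\alpha i,\beta i)$. Point-weak convergence $K_N\to K_\infty$ means $\langle u,K_N(\alpha,\beta)v\rangle\to\langle u,K_\infty(\alpha,\beta)v\rangle$ for all $\alpha,\beta\in\mathbb{F}_d^+$ and $u,v\in H$; the limit in the last formula is taken in this sense. *)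

theory Defs
  imports "HOL-Probability.Probability_Measure"
begin

section \<open>Complex Hilbert spaces\<close>

text \<open>
  A complex Hilbert space, presented over its underlying real Hilbert space: the real inner
  product is the real part of the complex one, so that norm, topology and completeness are those
  of \<^class>\<open>real_inner\<close> and \<^class>\<open>banach\<close>. The complex inner product is conjugate-linear in
  the first and linear in the second argument. No separability is assumed.
\<close>

class complex_hilbert = real_inner + banach +
  fixes scaleC :: "complex \<Rightarrow> 'a \<Rightarrow> 'a"  (infixr \<open>*\<^sub>C\<close> 75)
    and cinner :: "'a \<Rightarrow> 'a \<Rightarrow> complex"
  assumes scaleC_add_right: "a *\<^sub>C (x + y) = a *\<^sub>C x + a *\<^sub>C y"
    and scaleC_add_left: "(a + b) *\<^sub>C x = a *\<^sub>C x + b *\<^sub>C x"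
    and scaleC_scaleC: "a *\<^sub>C b *\<^sub>C x = (a * b) *\<^sub>C x"
    and scaleC_of_real: "complex_of_real r *\<^sub>C x = r *\<^sub>R x"
    and cinner_commute: "cinner x y = cnj (cinner y x)"
    and cinner_add_right: "cinner x (y + z) = cinner x y + cinner x z"
    and cinner_scaleC_right: "cinner x (a *\<^sub>C y) = a * cinner x y"
    and Re_cinner: "Re (cinner x y) = inner x y"

lemma cinner_add_left: "cinner (x + y) z = cinner x z + cinner y z"
  for x y z :: "'h::complex_hilbert"
  by (metis cinner_add_right cinner_commute complex_cnj_add)

lemma cinner_scaleC_left: "cinner (a *\<^sub>C x) y = cnj a * cinner x y"
  for x y :: "'h::complex_hilbert"
  by (metis cinner_commute cinner_scaleC_right complex_cnj_mult)

lemma Im_cinner: "Im (cinner x y) = inner (\<i> *\<^sub>C x) y"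
  for x y :: "'h::complex_hilbert"
  by (simp add: cinner_scaleC_left flip: Re_cinner)


section \<open>Bounded operators\<close>

typedef (overloaded) 'h bop =
  "{T :: 'h::complex_hilbert \<Rightarrow> 'h. bounded_linear T \<and> (\<forall>c x. T (c *\<^sub>C x) = c *\<^sub>C T x)}"
  morphisms bop_apply Bop
proof (rule exI, rule CollectI)
  show "bounded_linear (\<lambda>x::'h. x) \<and> (\<forall>c (x::'h). c *\<^sub>C x = c *\<^sub>C x)"
    by simp
qed

notation bop_apply (infixr \<open>\<cdot>\<close> 72)

setup_lifting type_definition_bop

lemma scaleC_zero_right: "c *\<^sub>C (0::'h::complex_hilbert) = 0"
  by (metis add_cancel_right_right scaleC_add_right)

lemma scaleC_diff_right: "c *\<^sub>C (x - y) = c *\<^sub>C x - c *\<^sub>C y"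
  for x y :: "'h::complex_hilbert"
  by (metis add_diff_cancel diff_add_cancel scaleC_add_right)

instantiation bop :: (complex_hilbert) ab_group_add
begin

lift_definition zero_bop :: "'a bop" is "\<lambda>_. 0"
  by (simp add: scaleC_zero_right)

lift_definition plus_bop :: "'a bop \<Rightarrow> 'a bop \<Rightarrow> 'a bop" is "\<lambda>S T x. S x + T x"
  by (simp add: bounded_linear_add scaleC_add_right)

lift_definition minus_bop :: "'a bop \<Rightarrow> 'a bop \<Rightarrow> 'a bop" is "\<lambda>S T x. S x - T x"
  by (simp add: bounded_linear_sub scaleC_diff_right)

lift_definition uminus_bop :: "'a bop \<Rightarrow> 'a bop" is "\<lambda>T x. - T x"
  by (metis (mono_tags, lifting) bounded_linear_minus diff_0 scaleC_diff_right scaleC_zero_right)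

instance
  by standard (transfer; force)+

end

lift_definition bop_id :: "'h::complex_hilbert bop" is "\<lambda>x. x"
  by simp

lift_definition bop_comp :: "'h::complex_hilbert bop \<Rightarrow> 'h bop \<Rightarrow> 'h bop" is "\<lambda>S T x. S (T x)"
  by (simp add: bounded_linear_compose)

definition bop_norm :: "'h::complex_hilbert bop \<Rightarrow> real" where
  "bop_norm T = onorm (bop_apply T)"

definition bop_adj :: "'h::complex_hilbert bop \<Rightarrow> 'h bop" where
  "bop_adj T = (THE S. \<forall>x y. cinner (T \<cdot> x) y = cinner x (S \<cdot> y))"

text \<open>The description defining \<^const>\<open>bop_adj\<close> is proper, by Riesz representation.\<close>

lemma riesz_real:
  fixes g :: "'h::{real_inner,banach} \<Rightarrow> real"
  assumes g: "bounded_linear g"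
  shows "\<exists>z. \<forall>x. g x = inner x z"
proof -
  interpret bounded_linear g by (rule g)
  define J where "J x = (norm x)\<^sup>2 - 2 * g x" for x
  obtain B where B: "\<And>x. norm (g x) \<le> norm x * B" using bounded by blast
  have low: "- (B\<^sup>2) \<le> J x" for x
  proof -
    have "g x \<le> norm x * B" using B[of x] by simp
    moreover have "0 \<le> (norm x - B)\<^sup>2" by simp
    ultimately show ?thesis unfolding J_def by (simp add: power2_eq_square algebra_simps)
  qed
  define m where "m = Inf (range J)"
  have bdd: "bdd_below (range J)" using low by (meson bdd_belowI2)
  have mle: "m \<le> J x" for x unfolding m_def by (rule cInf_lower) (use bdd in auto)
  have "\<exists>x. J x < m + 1 / Suc n" for n
  proof -
    have "Inf (range J) < m + 1 / Suc n" unfolding m_def by simp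
    then show ?thesis using cInf_lessD[of "range J"] by blast
  qed
  then obtain X where X: "\<And>n. J (X n) < m + 1 / Suc n" by metis
  have par: "(norm (x - y))\<^sup>2 = 2 * J x + 2 * J y - 4 * J ((1/2) *\<^sub>R (x + y))" for x y
    unfolding J_def
    by (simp add: power2_norm_eq_inner scale add inner_commute algebra_simps inner_add_left inner_add_right inner_diff_left inner_diff_right)
  have dist: "(norm (X i - X j))\<^sup>2 \<le> 4 / Suc N" if "N \<le> i" "N \<le> j" for i j N
  proof -
    have "1 / Suc i \<le> 1 / Suc N" "1 / Suc j \<le> 1 / Suc N" using that by (auto simp: divide_simps)
    moreover have "4 / real (Suc N) = 4 * (1 / Suc N)" by simp
    ultimately show ?thesis
      using par[of "X i" "X j"] X[of i] X[of j] mle[of "(1/2) *\<^sub>R (X i + X j)"] by linarith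
  qed
  have "Cauchy X"
  proof (rule metric_CauchyI)
    fix e :: real assume e: "0 < e"
    obtain N where "4 / e\<^sup>2 < real N" using reals_Archimedean2 by blast
    then have "4 / e\<^sup>2 < Suc N" by simp
    then have lt: "4 / Suc N < e\<^sup>2" using e by (simp add: field_simps)
    show "\<exists>M. \<forall>m\<ge>M. \<forall>n\<ge>M. dist (X m) (X n) < e"
    proof (intro exI allI impI)
      fix i j assume "N \<le> i" "N \<le> j"
      then have "(norm (X i - X j))\<^sup>2 < e\<^sup>2" using dist lt by fastforce
      then show "dist (X i) (X j) < e" using e by (metis dist_norm less_le power2_less_imp_less)
    qed
  qed
  then obtain z where z: "X \<longlonglongrightarrow> z" using Cauchy_convergent convergent_def by blast
  have lim_J: "(\<lambda>n. J (X n)) \<longlonglongrightarrow> J z" unfolding J_def by (intro tendsto_intros tendsto z)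
  have lim_m: "(\<lambda>n. m + 1 / Suc n) \<longlonglongrightarrow> m + 0"
    using tendsto_add[OF tendsto_const LIMSEQ_inverse_real_of_nat, of m]
    by (simp add: inverse_eq_divide)
  have "J z \<le> m + 0"
    by (rule LIMSEQ_le[OF lim_J lim_m]) (use X less_imp_le in blast)
  then have Jz: "J z \<le> m" by simp
  have "g h = inner h z" for h
  proof -
    define a where "a = inner h z - g h"
    have q: "0 \<le> t\<^sup>2 * (norm h)\<^sup>2 + 2 * t * a" for t
    proof -
      have "J (z + t *\<^sub>R h) = J z + t\<^sup>2 * (norm h)\<^sup>2 + 2 * t * a"
        unfolding J_def a_def
        by (simp add: power2_norm_eq_inner scale add inner_add_left inner_add_right inner_commute
            power2_eq_square[of t] algebra_simps)
      then show ?thesis using mle[of "z + t *\<^sub>R h"] Jz by linarith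
    qed
    define n where "n = (norm h)\<^sup>2 + 1"
    have n: "n \<ge> 1" unfolding n_def by simp
    have "0 \<le> (- a / n)\<^sup>2 * (norm h)\<^sup>2 + 2 * (- a / n) * a" by (rule q)
    also have "\<dots> = (a\<^sup>2 / n\<^sup>2) * (n - 1) - 2 * a\<^sup>2 / n"
      unfolding n_def by (simp add: power2_eq_square)
    also have "\<dots> = - (a\<^sup>2 * (n + 1)) / n\<^sup>2"
      using n by (simp add: field_simps power2_eq_square)
    finally have "a\<^sup>2 * (n + 1) \<le> 0" using n by (simp add: divide_simps split: if_splits)
    then have "a = 0" using n by (simp add: mult_le_0_iff)
    then show ?thesis unfolding a_def by simp
  qed
  then show ?thesis by blast
qed

lemma cinner_bop_adj:
  fixes T :: "'h::complex_hilbert bop"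
  shows "cinner (T \<cdot> x) y = cinner x (bop_adj T \<cdot> y)"
proof -
  have T: "bounded_linear (bop_apply T)" "\<And>c x. T \<cdot> c *\<^sub>C x = c *\<^sub>C (T \<cdot> x)"
    using bop_apply[of T] by auto
  have "\<exists>z. \<forall>x. inner (T \<cdot> x) y = inner x z" for y
    by (rule riesz_real) (intro bounded_linear_inner_left_comp T)
  then obtain S where S: "\<And>x y. inner (T \<cdot> x) y = inner x (S y)" by metis
  have cS: "cinner (T \<cdot> x) y = cinner x (S y)" for x y
    by (rule complex_eqI) (simp_all add: Re_cinner Im_cinner S flip: T(2))
  have eqI: "a = b" if "\<And>x. cinner x a = cinner x b" for a b :: 'h
    using that by (metis Re_cinner vector_eq_ldot)
  have S_add: "S (x + y) = S x + S y" for x y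
    by (rule eqI) (simp add: cinner_add_right flip: cS)
  have S_sc: "S (c *\<^sub>C x) = c *\<^sub>C S x" for c x
    by (rule eqI) (simp add: cinner_scaleC_right flip: cS)
  obtain B where B: "B \<ge> 0" "\<And>x. norm (T \<cdot> x) \<le> norm x * B"
    using bounded_linear.nonneg_bounded[OF T(1)] by blast
  have "norm (S y) \<le> norm y * B" for y
  proof -
    have "(norm (S y))\<^sup>2 = inner (T \<cdot> S y) y" by (simp add: S power2_norm_eq_inner)
    also have "\<dots> \<le> norm (T \<cdot> S y) * norm y" by (rule norm_cauchy_schwarz)
    also have "\<dots> \<le> norm (S y) * B * norm y" by (intro mult_right_mono B) simp
    finally show ?thesis
      using B(1) by (cases "S y = 0") (simp_all add: power2_eq_square algebra_simps)
  qed
  then have "bounded_linear S"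
    by (intro bounded_linear_intro[of S B]) (simp_all add: S_add S_sc flip: scaleC_of_real)
  then have "\<forall>x y. cinner (T \<cdot> x) y = cinner x (Bop S \<cdot> y)"
    by (simp add: Bop_inverse S_sc cS)
  moreover have "S1 = S2"
    if "\<forall>x y. cinner (T \<cdot> x) y = cinner x (S1 \<cdot> y)" "\<forall>x y. cinner (T \<cdot> x) y = cinner x (S2 \<cdot> y)"
    for S1 S2
    by (metis that eqI bop_apply_inject ext)
  ultimately have "\<exists>!S. \<forall>x y. cinner (T \<cdot> x) y = cinner x (S \<cdot> y)" by blast
  from theI'[OF this] show ?thesis unfolding bop_adj_def by blast
qed


section \<open>Kernels on the free semigroup\<close>

text \<open>
  The free semigroup on \<open>d\<close> generators (with neutral element) is \<^typ>\<open>'d list\<close> under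
  concatenation, where \<open>'d\<close> is a finite type with \<open>d\<close> elements and \<^term>\<open>[]\<close> is neutral.
\<close>

type_synonym ('d, 'h) kernel = "'d list \<Rightarrow> 'd list \<Rightarrow> 'h bop"

definition positive_definite :: "('d, 'h::complex_hilbert) kernel \<Rightarrow> bool" where
  "positive_definite K \<longleftrightarrow>
    (\<forall>(n::nat) (\<alpha> :: nat \<Rightarrow> 'd list) (u :: nat \<Rightarrow> 'h).
      (\<Sum>i<n. \<Sum>j<n. cinner (u i) (K (\<alpha> i) (\<alpha> j) \<cdot> u j)) \<in> \<real>\<^sub>\<ge>\<^sub>0)"

definition free_shift :: "('d::finite, 'h::complex_hilbert) kernel \<Rightarrow> ('d, 'h) kernel" where
  "free_shift K = (\<lambda>\<alpha> \<beta>. \<Sum>i\<in>UNIV. K (\<alpha> @ [i]) (\<beta> @ [i]))"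

definition point_weak_tendsto ::
    "(nat \<Rightarrow> ('d, 'h::complex_hilbert) kernel) \<Rightarrow> ('d, 'h) kernel \<Rightarrow> bool" where
  "point_weak_tendsto KN L \<longleftrightarrow>
    (\<forall>\<alpha> \<beta> u v. (\<lambda>N. cinner u (KN N \<alpha> \<beta> \<cdot> v)) \<longlonglongrightarrow> cinner u (L \<alpha> \<beta> \<cdot> v))"


section \<open>Moment kernels\<close>

definition word_op :: "('d \<Rightarrow> 'h::complex_hilbert bop) \<Rightarrow> 'd list \<Rightarrow> 'h bop" where
  "word_op A \<alpha> = foldr (\<lambda>i T. bop_comp (A i) T) \<alpha> bop_id"

definition strongly_measurable :: "'w measure \<Rightarrow> ('w \<Rightarrow> 'h::complex_hilbert bop) \<Rightarrow> bool" where
  "strongly_measurable M T \<longleftrightarrow> (\<forall>u. (\<lambda>\<omega>. T \<omega> \<cdot> u) \<in> borel_measurable M)"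

text \<open>
  The expectation of a random operator is understood weakly, through its matrix coefficients.
  Integrability includes measurability of the integrand, which for non-separable spaces does not
  follow from strong measurability.
\<close>

definition has_weak_expectation ::
    "'w measure \<Rightarrow> ('w \<Rightarrow> 'h::complex_hilbert bop) \<Rightarrow> 'h bop \<Rightarrow> bool" where
  "has_weak_expectation M T E \<longleftrightarrow>
    (\<forall>u v. has_bochner_integral M (\<lambda>\<omega>. cinner u (T \<omega> \<cdot> v)) (cinner u (E \<cdot> v)))"

definition moment_kernel ::
    "'w measure \<Rightarrow> ('d \<Rightarrow> 'w \<Rightarrow> 'h::complex_hilbert bop) \<Rightarrow> ('d, 'h) kernel \<Rightarrow> bool" where
  "moment_kernel M A K \<longleftrightarrow>
    prob_space M \<and>
    (\<forall>i. strongly_measurable M (A i)) \<and>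
    (\<forall>\<alpha>. integrable M (\<lambda>\<omega>. (bop_norm (word_op (\<lambda>i. A i \<omega>) \<alpha>))\<^sup>2)) \<and>
    (\<forall>\<alpha> \<beta>. has_weak_expectation M
      (\<lambda>\<omega>. bop_comp (word_op (\<lambda>i. A i \<omega>) \<alpha>) (bop_adj (word_op (\<lambda>i. A i \<omega>) \<beta>))) (K \<alpha> \<beta>))"

definition pure_unitary_decomposition ::
    "('d::finite, 'h::complex_hilbert) kernel \<Rightarrow> ('d, 'h) kernel \<Rightarrow> ('d, 'h) kernel \<Rightarrow> bool" where
  "pure_unitary_decomposition K K_pure K_unitary \<longleftrightarrow>
    positive_definite K_pure \<and> positive_definite K_unitary \<and>
    K = (\<lambda>\<alpha> \<beta>. K_pure \<alpha> \<beta> + K_unitary \<alpha> \<beta>) \<and>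
    free_shift K_unitary = K_unitary \<and>
    point_weak_tendsto (\<lambda>N. (free_shift ^^ N) K_pure) (\<lambda>_ _. 0)"

end

theory Submission
  imports Defs
begin

text \<open>
  The free shift preserves positivity, so the kernels \<open>\<Sigma>\<^sup>N K\<close> form a decreasing sequence of
  positive definite kernels. Its quadratic forms on finite families converge by monotonicity;
  polarisation gives convergence of all matrix coefficients, and the Riesz representation turns
  the limits into bounded operators. The limit kernel is the unitary part. Uniqueness holds since
  \<open>\<Sigma>\<^sup>N K = \<Sigma>\<^sup>N K\<^sub>p\<^sub>u\<^sub>r\<^sub>e + K\<^sub>u\<^sub>n\<^sub>i\<^sub>t\<^sub>a\<^sub>r\<^sub>y\<close> for every decomposition.
\<close>

section \<open>Elementary rules for the complex inner product and bounded operators\<close>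

lemma cinner_eqI:
  fixes a b :: "'h::complex_hilbert"
  assumes "\<And>u. cinner u a = cinner u b"
  shows "a = b"
  using assms by (metis Re_cinner vector_eq_ldot)

lemma bop_eqI:
  fixes S T :: "'h::complex_hilbert bop"
  assumes "\<And>u v. cinner u (S \<cdot> v) = cinner u (T \<cdot> v)"
  shows "S = T"
  using assms by (metis bop_apply_inject cinner_eqI ext)

lemma cinner_zero_right [simp]: "cinner u (0::'h::complex_hilbert) = 0"
  by (metis add_cancel_right_right cinner_add_right)

lemma cinner_diff_right: "cinner u (x - y) = cinner u x - cinner u y"
  for u x y :: "'h::complex_hilbert"
  by (metis add_diff_cancel cinner_add_right diff_add_cancel)

lemma bounded_linear_bop: "bounded_linear (bop_apply T)"
  using bop_apply[of T] by simp

lemma bop_scaleC: "T \<cdot> (c *\<^sub>C x) = c *\<^sub>C (T \<cdot> x)"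
  using bop_apply[of T] by simp

lemma bop_add: "T \<cdot> (x + y) = T \<cdot> x + T \<cdot> y"
  using bounded_linear_bop by (rule bounded_linear.linear[THEN linear_add])

lemma bop_minus: "T \<cdot> (- x) = - (T \<cdot> x)"
  using bounded_linear_bop by (rule bounded_linear.linear[THEN linear_neg])

lemma cinner_sum_bop: "cinner u ((\<Sum>i\<in>I. T i) \<cdot> v) = (\<Sum>i\<in>I. cinner u (T i \<cdot> v))"
  by (induction I rule: infinite_finite_induct)
    (simp_all add: zero_bop.rep_eq plus_bop.rep_eq cinner_add_right)

section \<open>Weak limits of operators\<close>

text \<open>For fixed \<open>v\<close>, real Riesz representation of the functional
  \<open>Re (b u v)\<close> of \<open>u\<close> yields a vector \<open>S v\<close>. Complex
  homogeneity then recovers the imaginary part and makes \<open>S\<close> complex linear, so only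
  the real part needs a bound.\<close>

lemma bounded_sesquilinear_representation:
  fixes b :: "'h::complex_hilbert \<Rightarrow> 'h \<Rightarrow> complex"
  assumes add_left: "\<And>u u' v. b (u + u') v = b u v + b u' v"
    and add_right: "\<And>u v v'. b u (v + v') = b u v + b u v'"
    and sc_left: "\<And>c u v. b (c *\<^sub>C u) v = cnj c * b u v"
    and sc_right: "\<And>c u v. b u (c *\<^sub>C v) = c * b u v"
    and C: "C \<ge> 0" and bound: "\<And>u v. \<bar>Re (b u v)\<bar> \<le> C * norm u * norm v"
  shows "\<exists>T. \<forall>u v. b u v = cinner u (T \<cdot> v)"
proof -
  have "\<exists>z. \<forall>u. Re (b u v) = inner u z" for v
  proof (rule riesz_real, rule bounded_linear_intro[of _ "C * norm v"])
    show "Re (b (r *\<^sub>R u) v) = r *\<^sub>R Re (b u v)" for r u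
      by (simp add: sc_left flip: scaleC_of_real)
    show "norm (Re (b u v)) \<le> norm u * (C * norm v)" for u
      using bound[of u v] by (simp add: mult_ac)
  qed (simp add: add_left)
  then obtain S where S: "\<And>u v. Re (b u v) = inner u (S v)" by metis
  have bS: "b u v = cinner u (S v)" for u v
  proof (rule complex_eqI)
    \<comment> \<open>Conjugate-linearity in the first slot turns the imaginary part at
      \<open>u\<close> into the real part at \<open>\<i> *\<^sub>C u\<close>.\<close>
    have "Im (b u v) = Re (b (\<i> *\<^sub>C u) v)" by (simp add: sc_left)
    then show "Im (b u v) = Im (cinner u (S v))" by (simp add: S Im_cinner)
  qed (simp add: S Re_cinner)
  have S_add: "S (x + y) = S x + S y" for x y
    by (rule cinner_eqI) (simp add: cinner_add_right add_right flip: bS)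
  have S_sc: "S (c *\<^sub>C x) = c *\<^sub>C S x" for c x
    by (rule cinner_eqI) (simp add: cinner_scaleC_right sc_right flip: bS)
  have "norm (S v) \<le> norm v * C" for v
  proof (cases "S v = 0")
    case False
    \<comment> \<open>Testing the form with \<open>u = S v\<close> bounds the square of the norm;
      one nonzero factor \<open>norm (S v)\<close> cancels.\<close>
    have "norm (S v) * norm (S v) = Re (b (S v) v)"
      by (simp add: S power2_norm_eq_inner flip: power2_eq_square)
    also have "\<dots> \<le> C * norm (S v) * norm v" using bound[of "S v" v] by simp
    finally show ?thesis using False by (simp add: mult_ac)
  qed (use C in simp)
  then have "bounded_linear S"
    by (intro bounded_linear_intro[of S C]) (simp_all add: S_add S_sc flip: scaleC_of_real)
  then have "\<forall>u v. b u v = cinner u (Bop S \<cdot> v)"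
    by (simp add: Bop_inverse S_sc bS)
  then show ?thesis by blast
qed

text \<open>The bound by a sum of squares is the one that positivity delivers. Since the limit form
  is homogeneous, rescaling both arguments to norm 1 upgrades it to a bound by the product of the
  norms.\<close>

lemma weak_operator_limit:
  fixes T :: "nat \<Rightarrow> 'h::complex_hilbert bop"
  assumes conv: "\<And>u v. convergent (\<lambda>N. inner u (T N \<cdot> v))"
    and C: "C \<ge> 0"
    and bound: "\<And>N u v. \<bar>inner u (T N \<cdot> v)\<bar> \<le> C * ((norm u)\<^sup>2 + (norm v)\<^sup>2)"
  shows "\<exists>L. \<forall>u v. (\<lambda>N. cinner u (T N \<cdot> v)) \<longlonglongrightarrow> cinner u (L \<cdot> v)"
proof -
  have "\<exists>l. (\<lambda>N. cinner u (T N \<cdot> v)) \<longlonglongrightarrow> l" for u v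
  proof -
    obtain r i where "(\<lambda>N. Re (cinner u (T N \<cdot> v))) \<longlonglongrightarrow> r"
      "(\<lambda>N. Im (cinner u (T N \<cdot> v))) \<longlonglongrightarrow> i"
      using conv[of u v] conv[of "\<i> *\<^sub>C u" v] by (auto simp: convergent_def Re_cinner Im_cinner)
    then show ?thesis by (intro exI[of _ "Complex r i"]) (simp add: tendsto_complex_iff)
  qed
  then obtain b where b: "\<And>u v. (\<lambda>N. cinner u (T N \<cdot> v)) \<longlonglongrightarrow> b u v" by metis
  have sc_left: "b (c *\<^sub>C u) v = cnj c * b u v" for c u v
    using b[of "c *\<^sub>C u" v] tendsto_mult_left[OF b[of u v], of "cnj c"]
    by (auto simp: cinner_scaleC_left intro: LIMSEQ_unique)
  have sc_right: "b u (c *\<^sub>C v) = c * b u v" for c u v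
    using b[of u "c *\<^sub>C v"] tendsto_mult_left[OF b[of u v], of c]
    by (auto simp: bop_scaleC cinner_scaleC_right intro: LIMSEQ_unique)
  have b_le: "\<bar>Re (b u v)\<bar> \<le> C * ((norm u)\<^sup>2 + (norm v)\<^sup>2)" for u v
  proof (rule LIMSEQ_le_const2)
    show "(\<lambda>N. \<bar>Re (cinner u (T N \<cdot> v))\<bar>) \<longlonglongrightarrow> \<bar>Re (b u v)\<bar>"
      by (intro tendsto_intros b)
  qed (use bound in \<open>simp add: Re_cinner\<close>)
  have "\<exists>L. \<forall>u v. b u v = cinner u (L \<cdot> v)"
  proof (rule bounded_sesquilinear_representation[OF _ _ sc_left sc_right])
    show "b (u + u') v = b u v + b u' v" for u u' v
      using b[of "u + u'" v] tendsto_add[OF b[of u v] b[of u' v]]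
      by (auto simp: cinner_add_left intro: LIMSEQ_unique)
    show "b u (v + v') = b u v + b u v'" for u v v'
      using b[of u "v + v'"] tendsto_add[OF b[of u v] b[of u v']]
      by (auto simp: bop_add cinner_add_right intro: LIMSEQ_unique)
    show "\<bar>Re (b u v)\<bar> \<le> (2 * C) * norm u * norm v" for u v
    proof (cases "u = 0 \<or> v = 0")
      \<comment> \<open>Zero vectors cannot be normalised; there the form vanishes by homogeneity
        with the scalar 0.\<close>
      case True
      have "b 0 v = 0" "b u 0 = 0"
        using sc_left[of 0 0 v] sc_right[of u 0 0] scaleC_of_real[of 0 "0::'h"] by simp_all
      with True show ?thesis by auto
    next
      case False
      define s t where "s = inverse (norm u)" and "t = inverse (norm v)"
      have st: "s > 0" "t > 0" using False by (simp_all add: s_def t_def)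
      have "b (s *\<^sub>R u) (t *\<^sub>R v) = complex_of_real (s * t) * b u v"
        by (simp add: sc_left sc_right flip: scaleC_of_real)
      then have "s * t * \<bar>Re (b u v)\<bar> = \<bar>Re (b (s *\<^sub>R u) (t *\<^sub>R v))\<bar>"
        using st by (simp add: abs_mult)
      \<comment> \<open>Both rescaled vectors have norm 1, so the sum of squares is 2; hence the
        constant \<open>2 * C\<close>.\<close>
      also have "\<dots> \<le> C * 2"
        using b_le[of "s *\<^sub>R u" "t *\<^sub>R v"] False by (simp add: s_def t_def)
      finally show ?thesis using False by (simp add: s_def t_def field_simps)
    qed
  qed (use C in simp)
  with b show ?thesis by metis
qed

section \<open>Positive definite kernels\<close>

lemma positive_definite_add:
  assumes "positive_definite K" "positive_definite L"
  shows "positive_definite (\<lambda>\<alpha> \<beta>. K \<alpha> \<beta> + L \<alpha> \<beta>)"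
  using assms unfolding positive_definite_def
  by (simp add: plus_bop.rep_eq cinner_add_right sum.distrib)

text \<open>Appending one letter \<open>k\<close> to all words of a family gives another family, on
  which the form of \<open>K\<close> is nonnegative. The form of the shifted kernel is the sum of
  these over all letters.\<close>

lemma positive_definite_free_shift:
  assumes "positive_definite K"
  shows "positive_definite (free_shift K)"
  unfolding positive_definite_def
proof (intro allI)
  fix n :: nat and \<alpha> :: "nat \<Rightarrow> 'a list" and u :: "nat \<Rightarrow> 'b"
  define S where "S k = (\<Sum>i<n. \<Sum>j<n. cinner (u i) (K (\<alpha> i @ [k]) (\<alpha> j @ [k]) \<cdot> u j))" for k
  have S: "S k \<in> \<real>\<^sub>\<ge>\<^sub>0" for k
    using assms unfolding positive_definite_def S_def
    by (elim allE[of _ n] allE[of _ "\<lambda>i. \<alpha> i @ [k]"] allE[of _ u])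
  have "(\<Sum>i<n. \<Sum>j<n. cinner (u i) (free_shift K (\<alpha> i) (\<alpha> j) \<cdot> u j)) = (\<Sum>k\<in>UNIV. S k)"
    unfolding free_shift_def S_def cinner_sum_bop
    by (subst sum.swap[of _ "{..<n}" UNIV], rule sum.cong[OF refl])
      (subst sum.swap, rule refl)
  also have "\<dots> \<in> \<real>\<^sub>\<ge>\<^sub>0"
    using S by (simp add: complex_nonneg_Reals_iff sum_nonneg)
  finally show "(\<Sum>i<n. \<Sum>j<n. cinner (u i) (free_shift K (\<alpha> i) (\<alpha> j) \<cdot> u j)) \<in> \<real>\<^sub>\<ge>\<^sub>0" .
qed

lemma positive_definite_limit:
  assumes "\<And>N. positive_definite (KN N)" "point_weak_tendsto KN L"
  shows "positive_definite L"
  unfolding positive_definite_def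
proof (intro allI)
  fix n :: nat and \<alpha> :: "nat \<Rightarrow> 'a list" and u :: "nat \<Rightarrow> 'b"
  have "(\<lambda>N. \<Sum>i<n. \<Sum>j<n. cinner (u i) (KN N (\<alpha> i) (\<alpha> j) \<cdot> u j))
      \<longlonglongrightarrow> (\<Sum>i<n. \<Sum>j<n. cinner (u i) (L (\<alpha> i) (\<alpha> j) \<cdot> u j))"
    using assms(2) unfolding point_weak_tendsto_def by (intro tendsto_sum) blast
  then show "(\<Sum>i<n. \<Sum>j<n. cinner (u i) (L (\<alpha> i) (\<alpha> j) \<cdot> u j)) \<in> \<real>\<^sub>\<ge>\<^sub>0"
    by (rule closed_sequentially[OF closed_nonneg_Reals_complex, rotated])
      (use assms(1) in \<open>simp add: positive_definite_def\<close>)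
qed

section \<open>Consequences of positivity on families of one or two words\<close>

lemma positive_definite_pair:
  assumes "positive_definite K"
  shows "cinner u (K \<alpha> \<alpha> \<cdot> u) + cinner u (K \<alpha> \<beta> \<cdot> v)
    + (cinner v (K \<beta> \<alpha> \<cdot> u) + cinner v (K \<beta> \<beta> \<cdot> v)) \<in> \<real>\<^sub>\<ge>\<^sub>0"
proof -
  \<comment> \<open>Families are indexed by all naturals, but with \<open>n = 2\<close> only the
    indices 0 and 1 enter.\<close>
  define w a where "w = (\<lambda>i::nat. if i = 0 then u else v)"
    and "a = (\<lambda>i::nat. if i = 0 then \<alpha> else \<beta>)"
  have "(\<Sum>i<2. \<Sum>j<2. cinner (w i) (K (a i) (a j) \<cdot> w j)) \<in> \<real>\<^sub>\<ge>\<^sub>0"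
    using assms unfolding positive_definite_def by blast
  then show ?thesis
    by (simp add: numeral_2_eq_2 w_def a_def)
qed

lemma positive_definite_diagonal:
  assumes "positive_definite K"
  shows "cinner u (K \<alpha> \<alpha> \<cdot> u) \<in> \<real>\<^sub>\<ge>\<^sub>0"
  using positive_definite_pair[OF assms, of u \<alpha> \<alpha> 0]
  by (simp add: linear_0[OF bounded_linear.linear[OF bounded_linear_bop]] cinner_commute[of 0])

text \<open>The two-word form is real also with \<open>\<i> *\<^sub>C v\<close> in place of
  \<open>v\<close>. Its diagonal terms are real, so the imaginary parts of the mixed terms cancel,
  and these are the real inner products up to sign.\<close>

lemma positive_definite_symmetric:
  assumes "positive_definite K"
  shows "inner v (K \<beta> \<alpha> \<cdot> u) = inner u (K \<alpha> \<beta> \<cdot> v)"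
  using positive_definite_pair[OF assms, of u \<alpha> \<beta> "\<i> *\<^sub>C v"]
    positive_definite_diagonal[OF assms, of u \<alpha>]
    positive_definite_diagonal[OF assms, of "\<i> *\<^sub>C v" \<beta>]
  by (simp add: complex_nonneg_Reals_iff bop_scaleC cinner_scaleC_left cinner_scaleC_right
      flip: Re_cinner)

lemma positive_definite_inner_pair:
  assumes "positive_definite K"
  shows "inner u (K \<alpha> \<alpha> \<cdot> u) + 2 * inner u (K \<alpha> \<beta> \<cdot> v) + inner v (K \<beta> \<beta> \<cdot> v) \<ge> 0"
  using positive_definite_pair[OF assms, of u \<alpha> \<beta> v] positive_definite_symmetric[OF assms, of v \<beta> \<alpha> u]
  by (simp add: complex_nonneg_Reals_iff Re_cinner)

lemma positive_definite_inner_diagonal: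
  assumes "positive_definite K"
  shows "inner u (K \<alpha> \<alpha> \<cdot> u) \<ge> 0"
  using positive_definite_diagonal[OF assms, of u \<alpha>] by (simp add: complex_nonneg_Reals_iff Re_cinner)

section \<open>Convergence of decreasing sequences of positive definite kernels\<close>

lemma decreasing_nonneg_convergent:
  fixes f :: "nat \<Rightarrow> real"
  assumes "\<And>N. f N \<ge> 0" "\<And>N. f (Suc N) \<le> f N"
  shows "convergent f"
proof -
  have "decseq f" using assms(2) by (rule decseq_SucI)
  then obtain l where "f \<longlonglongrightarrow> l" using decseq_convergent[of f 0] assms(1) by blast
  then show ?thesis by (rule convergentI)
qed

text \<open>Monotone convergence applies only to the real quadratic forms. An off-diagonal
  coefficient is half of the two-word form minus its two diagonal terms, so it converges as
  well.\<close>

lemma decreasing_kernels_converge: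
  fixes KN :: "nat \<Rightarrow> ('d, 'h::complex_hilbert) kernel"
  assumes pos: "\<And>N. positive_definite (KN N)"
    and dec: "\<And>N. positive_definite (\<lambda>\<alpha> \<beta>. KN N \<alpha> \<beta> - KN (Suc N) \<alpha> \<beta>)"
  shows "\<exists>L. point_weak_tendsto KN L"
proof -
  have conv_diag: "convergent (\<lambda>N. inner u (KN N \<alpha> \<alpha> \<cdot> u))" for u \<alpha>
    using positive_definite_inner_diagonal[OF pos, of u _ \<alpha>]
      positive_definite_inner_diagonal[OF dec, of u _ \<alpha>]
    by (intro decreasing_nonneg_convergent) (simp_all add: minus_bop.rep_eq inner_diff_right)
  \<comment> \<open>Monotonicity bounds all diagonal forms by those at \<open>N = 0\<close>, which
    makes the later estimate uniform in \<open>N\<close>.\<close>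
  have diag_le: "inner u (KN N \<alpha> \<alpha> \<cdot> u) \<le> inner u (KN 0 \<alpha> \<alpha> \<cdot> u)" for u \<alpha> N
    using lift_Suc_antimono_le[of "\<lambda>N. inner u (KN N \<alpha> \<alpha> \<cdot> u)" 0 N]
      positive_definite_inner_diagonal[OF dec, of u _ \<alpha>]
    by (simp add: minus_bop.rep_eq inner_diff_right)
  have "\<exists>L. \<forall>u v. (\<lambda>N. cinner u (KN N \<alpha> \<beta> \<cdot> v)) \<longlonglongrightarrow> cinner u (L \<cdot> v)" for \<alpha> \<beta>
  proof -
    \<comment> \<open>This is the form of \<open>KN N\<close> on the family of
      \<open>\<alpha>\<close> with \<open>u\<close> and \<open>\<beta>\<close> with
      \<open>v\<close>; its mixed terms coincide by symmetry.\<close>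
    define Q where "Q u v N =
        inner u (KN N \<alpha> \<alpha> \<cdot> u) + 2 * inner u (KN N \<alpha> \<beta> \<cdot> v) + inner v (KN N \<beta> \<beta> \<cdot> v)" for u v N
    have Q_nonneg: "Q u v N \<ge> 0" for u v N
      unfolding Q_def by (rule positive_definite_inner_pair[OF pos])
    \<comment> \<open>The difference of consecutive values of \<open>Q u v\<close> is the two-word
      form of a kernel in \<open>dec\<close>, so the sequence decreases.\<close>
    have conv_Q: "convergent (Q u v)" for u v
      using Q_nonneg positive_definite_inner_pair[OF dec, of u _ \<alpha> \<beta> v]
      by (intro decreasing_nonneg_convergent)
        (simp_all add: Q_def minus_bop.rep_eq inner_diff_right algebra_simps)
    define B where "B = onorm (bop_apply (KN 0 \<alpha> \<alpha>)) + onorm (bop_apply (KN 0 \<beta> \<beta>))"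
    have B_nonneg: "onorm (bop_apply T) \<ge> 0" for T :: "'h bop"
      by (rule onorm_pos_le[OF bounded_linear_bop])
    have diag0: "inner u (T \<cdot> u) \<le> onorm (bop_apply T) * (norm u)\<^sup>2" for u and T :: "'h bop"
    proof -
      have "inner u (T \<cdot> u) \<le> norm u * norm (T \<cdot> u)" by (rule norm_cauchy_schwarz)
      also have "\<dots> \<le> norm u * (onorm (bop_apply T) * norm u)"
        by (intro mult_left_mono onorm bounded_linear_bop) simp
      finally show ?thesis by (simp add: power2_eq_square mult_ac)
    qed
    show ?thesis
    proof (rule weak_operator_limit)
      fix u v
      have "(\<lambda>N. inner u (KN N \<alpha> \<beta> \<cdot> v)) =
          (\<lambda>N. (1/2) * (Q u v N - inner u (KN N \<alpha> \<alpha> \<cdot> u) - inner v (KN N \<beta> \<beta> \<cdot> v)))"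
        by (simp add: Q_def)
      moreover have "convergent \<dots>"
        by (intro convergent_mult convergent_const convergent_diff conv_Q conv_diag)
      ultimately show "convergent (\<lambda>N. inner u (KN N \<alpha> \<beta> \<cdot> v))" by simp
    next
      fix N u v
      have "2 * \<bar>inner u (KN N \<alpha> \<beta> \<cdot> v)\<bar>
          \<le> inner u (KN N \<alpha> \<alpha> \<cdot> u) + inner v (KN N \<beta> \<beta> \<cdot> v)"
        \<comment> \<open>Passing to \<open>- v\<close> flips the sign of the mixed term only, so
          both signs together bound its absolute value.\<close>
        using Q_nonneg[of u v N] Q_nonneg[of u "- v" N] by (simp add: Q_def bop_minus)
      also have "\<dots> \<le> onorm (bop_apply (KN 0 \<alpha> \<alpha>)) * (norm u)\<^sup>2
          + onorm (bop_apply (KN 0 \<beta> \<beta>)) * (norm v)\<^sup>2"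
        by (intro add_mono order_trans[OF diag_le diag0])
      also have "\<dots> \<le> B * (norm u)\<^sup>2 + B * (norm v)\<^sup>2"
        unfolding B_def by (intro add_mono mult_right_mono) (simp_all add: B_nonneg)
      also have "\<dots> = B * ((norm u)\<^sup>2 + (norm v)\<^sup>2)"
        by (simp add: distrib_left)
      finally show "\<bar>inner u (KN N \<alpha> \<beta> \<cdot> v)\<bar> \<le> B * ((norm u)\<^sup>2 + (norm v)\<^sup>2)" by simp
    qed (simp add: B_def B_nonneg)
  qed
  then obtain L where
    "\<And>\<alpha> \<beta> u v. (\<lambda>N. cinner u (KN N \<alpha> \<beta> \<cdot> v)) \<longlonglongrightarrow> cinner u (L \<alpha> \<beta> \<cdot> v)"
    by metis
  then show ?thesis unfolding point_weak_tendsto_def by blast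
qed

section \<open>Iterates of the free shift\<close>

lemma point_weak_tendsto_add:
  assumes "point_weak_tendsto KN K" "point_weak_tendsto LN L"
  shows "point_weak_tendsto (\<lambda>N \<alpha> \<beta>. KN N \<alpha> \<beta> + LN N \<alpha> \<beta>) (\<lambda>\<alpha> \<beta>. K \<alpha> \<beta> + L \<alpha> \<beta>)"
  using assms unfolding point_weak_tendsto_def
  by (simp add: plus_bop.rep_eq cinner_add_right tendsto_add)

lemma point_weak_tendsto_diff:
  assumes "point_weak_tendsto KN K" "point_weak_tendsto LN L"
  shows "point_weak_tendsto (\<lambda>N \<alpha> \<beta>. KN N \<alpha> \<beta> - LN N \<alpha> \<beta>) (\<lambda>\<alpha> \<beta>. K \<alpha> \<beta> - L \<alpha> \<beta>)"
  using assms unfolding point_weak_tendsto_def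
  by (simp add: minus_bop.rep_eq cinner_diff_right tendsto_diff)

lemma point_weak_tendsto_const: "point_weak_tendsto (\<lambda>_. K) K"
  unfolding point_weak_tendsto_def by simp

lemma point_weak_tendsto_unique:
  assumes "point_weak_tendsto KN K" "point_weak_tendsto KN L"
  shows "K = L"
proof (intro ext bop_eqI)
  show "cinner u (K \<alpha> \<beta> \<cdot> v) = cinner u (L \<alpha> \<beta> \<cdot> v)" for \<alpha> \<beta> u v
    using assms unfolding point_weak_tendsto_def by (blast intro: LIMSEQ_unique)
qed

text \<open>The alphabet is finite, so the shift is a finite sum and commutes with pointwise weak
  limits.\<close>

lemma point_weak_tendsto_free_shift:
  assumes "point_weak_tendsto KN K"
  shows "point_weak_tendsto (\<lambda>N. free_shift (KN N)) (free_shift K)"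
  using assms unfolding point_weak_tendsto_def free_shift_def cinner_sum_bop
  by (intro allI tendsto_sum) blast

lemma free_shift_power_add:
  "(free_shift ^^ N) (\<lambda>\<alpha> \<beta>. K \<alpha> \<beta> + L \<alpha> \<beta>) =
    (\<lambda>\<alpha> \<beta>. (free_shift ^^ N) K \<alpha> \<beta> + (free_shift ^^ N) L \<alpha> \<beta>)"
  by (induction N) (simp_all add: free_shift_def sum.distrib)

lemma free_shift_power_diff:
  "(free_shift ^^ N) (\<lambda>\<alpha> \<beta>. K \<alpha> \<beta> - L \<alpha> \<beta>) =
    (\<lambda>\<alpha> \<beta>. (free_shift ^^ N) K \<alpha> \<beta> - (free_shift ^^ N) L \<alpha> \<beta>)"
  by (induction N) (simp_all add: free_shift_def sum_subtractf)

lemma free_shift_power_invariant: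
  assumes "free_shift K = K"
  shows "(free_shift ^^ N) K = K"
  by (induction N) (simp_all add: assms)

lemma positive_definite_free_shift_power:
  assumes "positive_definite K"
  shows "positive_definite ((free_shift ^^ N) K)"
  by (induction N) (simp_all add: assms positive_definite_free_shift)

section \<open>The decomposition: limit formula, uniqueness and existence\<close>

lemma pure_unitary_decomposition_limit:
  assumes "pure_unitary_decomposition K P U"
  shows "point_weak_tendsto (\<lambda>N. (free_shift ^^ N) K) U"
proof -
  have K: "K = (\<lambda>\<alpha> \<beta>. P \<alpha> \<beta> + U \<alpha> \<beta>)"
    and U: "free_shift U = U"
    and P: "point_weak_tendsto (\<lambda>N. (free_shift ^^ N) P) (\<lambda>_ _. 0)"
    using assms unfolding pure_unitary_decomposition_def by auto
  show ?thesis
    using point_weak_tendsto_add[OF P point_weak_tendsto_const[of U]]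
    by (simp add: K free_shift_power_add free_shift_power_invariant[OF U])
qed

lemma pure_unitary_decomposition_unique:
  assumes "pure_unitary_decomposition K P U" "pure_unitary_decomposition K P' U'"
  shows "P' = P \<and> U' = U"
proof -
  have U: "U' = U"
    using assms by (blast intro: point_weak_tendsto_unique pure_unitary_decomposition_limit)
  have "(\<lambda>\<alpha> \<beta>. P' \<alpha> \<beta> + U' \<alpha> \<beta>) = (\<lambda>\<alpha> \<beta>. P \<alpha> \<beta> + U \<alpha> \<beta>)"
    using assms unfolding pure_unitary_decomposition_def by metis
  then have "P' = P"
    \<comment> \<open>Both unitary parts are limits of the same sequence; once identified, they
      cancel from the two sums.\<close>
    unfolding U by (simp add: fun_eq_iff)
  with U show ?thesis by blast
qed

lemma pure_unitary_decomposition_exists: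
  fixes K :: "('d::finite, 'h::complex_hilbert) kernel"
  assumes pos: "positive_definite K"
    and dec: "positive_definite (\<lambda>\<alpha> \<beta>. K \<alpha> \<beta> - free_shift K \<alpha> \<beta>)"
  shows "\<exists>P U. pure_unitary_decomposition K P U"
proof -
  let ?K = "\<lambda>N. (free_shift ^^ N) K"
  \<comment> \<open>This difference is the \<open>N\<close>-th shift iterate of
    \<open>K - free_shift K\<close>, and the shift preserves positivity.\<close>
  have dec_N: "positive_definite (\<lambda>\<alpha> \<beta>. ?K N \<alpha> \<beta> - ?K (Suc N) \<alpha> \<beta>)" for N
    using positive_definite_free_shift_power[OF dec, of N]
    by (simp add: free_shift_power_diff funpow_swap1)
  \<comment> \<open>Telescoping: \<open>K\<close> minus the \<open>N\<close>-th iterate is the sum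
    of the first \<open>N\<close> consecutive differences. Its limit will be the pure part.\<close>
  have K_ge: "positive_definite (\<lambda>\<alpha> \<beta>. K \<alpha> \<beta> - ?K N \<alpha> \<beta>)" for N
  proof (induction N)
    case (Suc N)
    then show ?case
      using positive_definite_add[OF Suc dec_N[of N]] by simp
  qed (simp add: positive_definite_def zero_bop.rep_eq)
  obtain U where U: "point_weak_tendsto ?K U"
    using decreasing_kernels_converge[of ?K] positive_definite_free_shift_power[OF pos] dec_N by blast
  have "point_weak_tendsto (\<lambda>N. ?K (Suc N)) U"
    using U unfolding point_weak_tendsto_def by (intro allI LIMSEQ_Suc) blast
  \<comment> \<open>The sequence advanced by one index tends to \<open>U\<close>, and by continuity
    of the shift also to \<open>free_shift U\<close>.\<close>
  with point_weak_tendsto_free_shift[OF U] have inv: "free_shift U = U"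
    by (intro point_weak_tendsto_unique) simp_all
  have "pure_unitary_decomposition K (\<lambda>\<alpha> \<beta>. K \<alpha> \<beta> - U \<alpha> \<beta>) U"
    unfolding pure_unitary_decomposition_def
  proof (intro conjI inv)
    show "positive_definite (\<lambda>\<alpha> \<beta>. K \<alpha> \<beta> - U \<alpha> \<beta>)"
      using K_ge point_weak_tendsto_diff[OF point_weak_tendsto_const U] by (rule positive_definite_limit)
    show "positive_definite U"
      using positive_definite_free_shift_power[OF pos] U by (rule positive_definite_limit)
    show "point_weak_tendsto (\<lambda>N. (free_shift ^^ N) (\<lambda>\<alpha> \<beta>. K \<alpha> \<beta> - U \<alpha> \<beta>)) (\<lambda>_ _. 0)"
      \<comment> \<open>As \<open>U\<close> is fixed by the shift, the iterates of
        \<open>K - U\<close> are those of \<open>K\<close> minus the constant \<open>U\<close>,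
        which tend to 0.\<close>
      using point_weak_tendsto_diff[OF U point_weak_tendsto_const[of U]]
      by (simp add: free_shift_power_diff free_shift_power_invariant[OF inv])
  qed simp
  then show ?thesis by blast
qed

theorem theorem5p2:
  fixes M :: "'w measure"
    and A :: "'d::finite \<Rightarrow> 'w \<Rightarrow> 'h::complex_hilbert bop"
    and K :: "('d, 'h) kernel"
  assumes "moment_kernel M A K"
    and "positive_definite K"
    and "positive_definite (\<lambda>\<alpha> \<beta>. K \<alpha> \<beta> - free_shift K \<alpha> \<beta>)"
  shows "\<exists>K_pure K_unitary.
      pure_unitary_decomposition K K_pure K_unitary \<and>
      (\<forall>K_pure' K_unitary'. pure_unitary_decomposition K K_pure' K_unitary' \<longrightarrow>
         K_pure' = K_pure \<and> K_unitary' = K_unitary) \<and>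
      point_weak_tendsto (\<lambda>N. (free_shift ^^ N) K) K_unitary"
proof -
  obtain P U where PU: "pure_unitary_decomposition K P U"
    using pure_unitary_decomposition_exists[OF assms(2,3)] by blast
  show ?thesis
  proof (intro exI conjI allI impI)
    show "pure_unitary_decomposition K P U" by (rule PU)
    show "point_weak_tendsto (\<lambda>N. (free_shift ^^ N) K) U"
      using PU by (rule pure_unitary_decomposition_limit)
    show "P' = P" "U' = U" if "pure_unitary_decomposition K P' U'" for P' U'
      using pure_unitary_decomposition_unique[OF PU that] by simp_all
  qed
qed

end
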